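(* Let $A$ be a non-trivial finitely generated group and $S_A$ a finite symmetric generating set of $A$ such that $(A,S_A)$ has unbounded depth. Let $B$ be any finitely generated group. Then there exists a finite symmetric generating set $S_B$ of $B$ such that $(A\wr B, S_A\cup S_B)$ has unbounded depth.
   Context: For a group $G$ with finite symmetric generating set $S$, $\|g\|_S$ denotes the word length of $g\in G$. An element $g\in G$ is a dead end of $(G,S)$ if $\|gs\|_S\le \|g\|_S$ for all $s\in S$; its depth is the maximal $n\ge 1$ such that $\|gs_1\cdots s_k\|_S\le \|g\|_S$ for all $k\le n$ and all $s_1,\dots,s_k\in S$ (the depth is infinite if there is no maximal such $n$, which can happen only when $G$ is finite). $(G,S)$ has unbounded depth if for every $n\in\mathbb{N}$ there is a dead end of depth at least $n$ (in particular every finite group has unbounded depth); otherwise it has uniformly bounded depth. The wreath product $A\wr B$ is $\bigoplus_B A\rtimes B$, where $\bigoplus_B A$ is the group of finitely supported functions $f:B\to A$ with pointwise multiplication and $B$ acts by $(b\cdot f)(x)=f(b^{-1}x)$; so $(f,b)(f',b')=(f\,(b\cdot f'),bb')$. $B$ embeds by $b\mapsto(\mathbf 1,b)$ with $\mathbf 1$ the constant function $e_A$, and $A$ embeds by $a\mapsto(\delta^a,e_B)$ with $\delta^a(e_B)=a$ and $\delta^a(x)=e_A$ for $x\ne e_B$. Via these embeddings $S_A\cup S_B$ is a generating set of $A\wr B$. *)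

theory Defs
  imports "HOL-Algebra.Algebra" "HOL-Library.Extended_Nat"
begin

definition sym_gen_set :: "('a, 'c) monoid_scheme \<Rightarrow> 'a set \<Rightarrow> bool" where
  "sym_gen_set G S \<longleftrightarrow>
     finite S \<and> S \<subseteq> carrier G \<and> (\<forall>s\<in>S. inv\<^bsub>G\<^esub> s \<in> S) \<and> generate G S = carrier G"

definition fin_gen :: "('a, 'c) monoid_scheme \<Rightarrow> bool" where
  "fin_gen G \<longleftrightarrow> (\<exists>T. finite T \<and> T \<subseteq> carrier G \<and> generate G T = carrier G)"

definition word_prod :: "('a, 'c) monoid_scheme \<Rightarrow> 'a list \<Rightarrow> 'a" where
  "word_prod G w = foldr (\<otimes>\<^bsub>G\<^esub>) w \<one>\<^bsub>G\<^esub>"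

text \<open>Only meaningful if every element of the group is a product of elements of \<open>S\<close>, e.g. if
  \<open>S\<close> is a symmetric generating set.\<close>

definition word_length :: "('a, 'c) monoid_scheme \<Rightarrow> 'a set \<Rightarrow> 'a \<Rightarrow> nat" where
  "word_length G S g = (LEAST n. \<exists>w \<in> lists S. length w = n \<and> word_prod G w = g)"

definition dead_end :: "('a, 'c) monoid_scheme \<Rightarrow> 'a set \<Rightarrow> 'a \<Rightarrow> bool" where
  "dead_end G S g \<longleftrightarrow>
     g \<in> carrier G \<and> (\<forall>s\<in>S. word_length G S (g \<otimes>\<^bsub>G\<^esub> s) \<le> word_length G S g)"

text \<open>The supremum in \<^typ>\<open>enat\<close> is the maximum when it exists and \<open>\<infinity>\<close> when the set is infinite;
  for a dead end the set contains 1.\<close>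

definition depth :: "('a, 'c) monoid_scheme \<Rightarrow> 'a set \<Rightarrow> 'a \<Rightarrow> enat" where
  "depth G S g = Sup {enat n |n. n \<ge> 1 \<and>
     (\<forall>w \<in> lists S. length w \<le> n \<longrightarrow>
        word_length G S (g \<otimes>\<^bsub>G\<^esub> word_prod G w) \<le> word_length G S g)}"

definition unbounded_depth :: "('a, 'c) monoid_scheme \<Rightarrow> 'a set \<Rightarrow> bool" where
  "unbounded_depth G S \<longleftrightarrow> (\<forall>n::nat. \<exists>g. dead_end G S g \<and> depth G S g \<ge> enat n)"

text \<open>\<^const>\<open>sum_group\<close> consists of the finitely supported functions \<open>carrier B \<rightarrow> carrier A\<close>,
  represented as extensional functions, with pointwise multiplication.\<close>

abbreviation base_group ::
    "('a, 'c) monoid_scheme \<Rightarrow> ('b, 'd) monoid_scheme \<Rightarrow> ('b \<Rightarrow> 'a) monoid" where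
  "base_group A B \<equiv> sum_group (carrier B) (\<lambda>_. A)"

definition shift :: "('b, 'd) monoid_scheme \<Rightarrow> 'b \<Rightarrow> ('b \<Rightarrow> 'a) \<Rightarrow> ('b \<Rightarrow> 'a)" where
  "shift B b f = (\<lambda>x\<in>carrier B. f (inv\<^bsub>B\<^esub> b \<otimes>\<^bsub>B\<^esub> x))"

definition wreath ::
    "('a, 'c) monoid_scheme \<Rightarrow> ('b, 'd) monoid_scheme \<Rightarrow> (('b \<Rightarrow> 'a) \<times> 'b) monoid" where
  "wreath A B =
     \<lparr>carrier = carrier (base_group A B) \<times> carrier B,
      monoid.mult = (\<lambda>(f, b) (f', b'). (f \<otimes>\<^bsub>base_group A B\<^esub> shift B b f', b \<otimes>\<^bsub>B\<^esub> b')),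
      one = (\<one>\<^bsub>base_group A B\<^esub>, \<one>\<^bsub>B\<^esub>)\<rparr>"

definition embed_base ::
    "('a, 'c) monoid_scheme \<Rightarrow> ('b, 'd) monoid_scheme \<Rightarrow> 'a \<Rightarrow> ('b \<Rightarrow> 'a) \<times> 'b" where
  "embed_base A B a = (\<lambda>x\<in>carrier B. if x = \<one>\<^bsub>B\<^esub> then a else \<one>\<^bsub>A\<^esub>, \<one>\<^bsub>B\<^esub>)"

definition embed_top ::
    "('a, 'c) monoid_scheme \<Rightarrow> ('b, 'd) monoid_scheme \<Rightarrow> 'b \<Rightarrow> ('b \<Rightarrow> 'a) \<times> 'b" where
  "embed_top A B b = (\<one>\<^bsub>base_group A B\<^esub>, b)"

lemma wreath_carrier_iff:
  assumes "group A"
  shows "(f, b) \<in> carrier (wreath A B) \<longleftrightarrow>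
    f \<in> carrier B \<rightarrow>\<^sub>E carrier A \<and> finite {x \<in> carrier B. f x \<noteq> \<one>\<^bsub>A\<^esub>} \<and> b \<in> carrier B"
  using assms by (simp add: wreath_def carrier_sum_group)

lemma shift_closed:
  assumes "group A" "group B" "b \<in> carrier B" "f \<in> carrier (base_group A B)"
  shows "shift B b f \<in> carrier (base_group A B)"
proof -
  interpret B: group B by fact
  have f: "f \<in> carrier B \<rightarrow>\<^sub>E carrier A" "finite {x \<in> carrier B. f x \<noteq> \<one>\<^bsub>A\<^esub>}"
    using assms by (auto simp: carrier_sum_group)
  have "{x \<in> carrier B. shift B b f x \<noteq> \<one>\<^bsub>A\<^esub>}
      \<subseteq> (\<lambda>y. b \<otimes>\<^bsub>B\<^esub> y) ` {x \<in> carrier B. f x \<noteq> \<one>\<^bsub>A\<^esub>}"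
  proof
    fix x assume x: "x \<in> {x \<in> carrier B. shift B b f x \<noteq> \<one>\<^bsub>A\<^esub>}"
    then have "x = b \<otimes>\<^bsub>B\<^esub> (inv\<^bsub>B\<^esub> b \<otimes>\<^bsub>B\<^esub> x)"
      using assms by (simp flip: B.m_assoc)
    with x show "x \<in> (\<lambda>y. b \<otimes>\<^bsub>B\<^esub> y) ` {x \<in> carrier B. f x \<noteq> \<one>\<^bsub>A\<^esub>}"
      using assms by (intro image_eqI) (auto simp: shift_def)
  qed
  then have "finite {x \<in> carrier B. shift B b f x \<noteq> \<one>\<^bsub>A\<^esub>}"
    using f(2) by (meson finite_imageI finite_subset)
  moreover have "shift B b f \<in> carrier B \<rightarrow>\<^sub>E carrier A"
    using f(1) assms by (auto simp: shift_def)
  ultimately show ?thesis using assms by (simp add: carrier_sum_group)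
qed

lemma group_wreath:
  fixes A :: "('a, 'c) monoid_scheme" and B :: "('b, 'd) monoid_scheme"
  assumes A: "group A" and B: "group B"
  shows "group (wreath A B)"
proof -
  interpret A: group A by fact
  interpret B: group B by fact
  interpret N: group "base_group A B" by (simp add: A)
  have one_shift: "shift B \<one>\<^bsub>B\<^esub> f = f" if "f \<in> carrier (base_group A B)" for f :: "'b \<Rightarrow> 'a"
    using that A by (fastforce simp: shift_def carrier_sum_group PiE_iff extensional_def)
  have shift_mult: "shift B b (f \<otimes>\<^bsub>base_group A B\<^esub> g)
      = shift B b f \<otimes>\<^bsub>base_group A B\<^esub> shift B b g" if "b \<in> carrier B" for b and f g :: "'b \<Rightarrow> 'a"
    using that by (auto simp: shift_def)
  have shift_shift: "shift B b (shift B b' f) = shift B (b \<otimes>\<^bsub>B\<^esub> b') f"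
    if "b \<in> carrier B" "b' \<in> carrier B" for b b' and f :: "'b \<Rightarrow> 'a"
    using that by (auto simp: shift_def B.inv_mult_group B.m_assoc)
  have shift_one: "shift B b \<one>\<^bsub>base_group A B\<^esub> = \<one>\<^bsub>base_group A B\<^esub>" if "b \<in> carrier B" for b
    using that by (auto simp: shift_def)
  note cl = shift_closed[OF A B]
  note [simp del] = mult_sum_group one_sum_group inv_sum_group
  show ?thesis
  proof (rule groupI)
    fix x assume x: "x \<in> carrier (wreath A B)"
    obtain f b where fb: "x = (f, b)" by fastforce
    have f: "f \<in> carrier (base_group A B)" "b \<in> carrier B"
      using x fb by (auto simp: wreath_def)
    show "\<one>\<^bsub>wreath A B\<^esub> \<otimes>\<^bsub>wreath A B\<^esub> x = x"
      using f fb by (simp add: wreath_def one_shift)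
    let ?y = "(shift B (inv\<^bsub>B\<^esub> b) (inv\<^bsub>base_group A B\<^esub> f), inv\<^bsub>B\<^esub> b)"
    have "?y \<in> carrier (wreath A B)"
      using f cl by (simp add: wreath_def)
    moreover have "?y \<otimes>\<^bsub>wreath A B\<^esub> x = \<one>\<^bsub>wreath A B\<^esub>"
      using f fb by (simp add: wreath_def shift_one flip: shift_mult)
    ultimately show "\<exists>y \<in> carrier (wreath A B). y \<otimes>\<^bsub>wreath A B\<^esub> x = \<one>\<^bsub>wreath A B\<^esub>"
      by blast
  qed (auto simp: wreath_def cl shift_mult shift_shift N.m_assoc B.m_assoc)
qed

lemma embed_base_hom:
  assumes A: "group A" and B: "group B"
  shows "embed_base A B \<in> hom A (wreath A B)" "inj_on (embed_base A B) (carrier A)"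
proof -
  interpret A: group A by fact
  interpret B: group B by fact
  have fin: "finite {x \<in> carrier B. x = \<one>\<^bsub>B\<^esub> \<and> P x}" for P
    by (rule finite_subset[of _ "{\<one>\<^bsub>B\<^esub>}"]) auto
  have "finite {x \<in> carrier B. (if x = \<one>\<^bsub>B\<^esub> then a else \<one>\<^bsub>A\<^esub>) \<noteq> \<one>\<^bsub>A\<^esub>}" for a
    by (rule finite_subset[of _ "{\<one>\<^bsub>B\<^esub>}"]) (auto split: if_splits)
  then show "embed_base A B \<in> hom A (wreath A B)"
    using A by (auto simp: hom_def embed_base_def wreath_def carrier_sum_group shift_def
        cong: conj_cong intro!: restrict_ext)
  show "inj_on (embed_base A B) (carrier A)"
    by (auto simp: inj_on_def embed_base_def dest!: fun_cong[where x = "\<one>\<^bsub>B\<^esub>"])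
qed

lemma embed_top_hom:
  assumes A: "group A" and B: "group B"
  shows "embed_top A B \<in> hom B (wreath A B)" "inj_on (embed_top A B) (carrier B)"
proof -
  interpret A: group A by fact
  interpret B: group B by fact
  show "embed_top A B \<in> hom B (wreath A B)"
    using A by (auto simp: hom_def embed_top_def wreath_def carrier_sum_group shift_def
        intro!: restrict_ext)
  show "inj_on (embed_top A B) (carrier B)"
    by (auto simp: inj_on_def embed_top_def)
qed

end

theory Submission
  imports Defs
begin

text \<open>Take for \<open>S_B\<close> the ball of radius 3 with respect to a finite symmetric generating set \<open>T\<close> of
  \<open>B\<close>. By Sekanina's theorem (the cube of a finite connected graph is Hamilton-connected) the
  \<open>T\<close>-ball \<open>F\<close> of radius \<open>3n\<close> is Hamilton-connected in the Cayley graph of \<open>(B, S_B)\<close>. Let \<open>a\<close> be a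
  dead end of \<open>A\<close> of depth at least \<open>n\<close> and let \<open>g\<close> have the lamp value \<open>a\<close> at every point of \<open>F\<close>
  and its cursor at \<open>1\<close>. If \<open>F\<close> has at least two elements, a word for \<open>g\<close> contains a closed tour
  through \<open>F\<close>, so \<open>g\<close> has length at least \<open>|F| (|a| + 1)\<close>. After at most \<open>n\<close> letters the cursor
  is still in \<open>F\<close> and no lamp value has become longer than \<open>a\<close>; a Hamiltonian path of \<open>F\<close> from \<open>1\<close>
  to the cursor (or a Hamiltonian cycle) then gives a word of length at most \<open>|F| (|a| + 1)\<close>.\<close>

section \<open>Hamiltonian paths in the cube of a connected graph\<close>

text \<open>Connectivity of the subgraph induced on \<open>V\<close>: the edge set stays fixed while
  an induction shrinks \<open>V\<close>.\<close>

definition connected_in :: "('v \<times> 'v) set \<Rightarrow> 'v set \<Rightarrow> bool" where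
  "connected_in E V \<longleftrightarrow> (\<forall>x\<in>V. \<forall>y\<in>V. (x, y) \<in> (E \<inter> V \<times> V)\<^sup>*)"

text \<open>As \<open>p\<close> is distinct, \<open>u = v\<close> forces \<open>V\<close> to be a
  singleton; closed tours are treated separately. Nonemptiness keeps \<open>hd\<close> and
  \<open>last\<close> meaningful.\<close>

definition ham_path :: "('v \<times> 'v) set \<Rightarrow> 'v set \<Rightarrow> 'v \<Rightarrow> 'v \<Rightarrow> 'v list \<Rightarrow> bool" where
  "ham_path R V u v p \<longleftrightarrow> p \<noteq> [] \<and> distinct p \<and> set p = V \<and> hd p = u \<and> last p = v \<and>
     successively (\<lambda>x y. (x, y) \<in> R) p"

lemma ham_path_append:
  assumes "ham_path R V u u' p" "ham_path R W v' v q" "V \<inter> W = {}" "(u', v') \<in> R"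
  shows "ham_path R (V \<union> W) u v (p @ q)"
  using assms unfolding ham_path_def by (auto simp: successively_append_iff)

lemma ham_path_mono: "ham_path R V u v p \<Longrightarrow> R \<subseteq> R' \<Longrightarrow> ham_path R' V u v p"
  unfolding ham_path_def by (auto elim!: successively_mono)

lemma ham_path_rev:
  assumes "ham_path R V u v p" "sym R"
  shows "ham_path R V v u (rev p)"
proof -
  have "successively (\<lambda>x y. (y, x) \<in> R) p"
    using assms unfolding ham_path_def by (auto elim!: successively_mono dest: symD)
  then show ?thesis
    using assms unfolding ham_path_def by (auto simp: successively_rev hd_rev last_rev)
qed

lemma connected_in_neighbour:
  assumes "connected_in E V" "u \<in> V" "v \<in> V" "u \<noteq> v"
  obtains w where "w \<in> V" "w \<noteq> u" "(u, w) \<in> E"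
proof -
  have "(u, v) \<in> (E \<inter> V \<times> V)\<^sup>*"
    using assms unfolding connected_in_def by blast
  then have "\<exists>w\<in>V. w \<noteq> u \<and> (u, w) \<in> E"
    using \<open>u \<noteq> v\<close>
  proof (induction rule: rtrancl_induct)
    case (step y z)
    then show ?case by (cases "y = u") auto
  qed auto
  then show thesis using that by blast
qed

text \<open>The part containing \<open>v\<close> is the component of \<open>v\<close> after deleting the vertex \<open>u\<close>.\<close>

lemma connected_in_split:
  assumes "sym E" "connected_in E V" "u \<in> V" "v \<in> V" "u \<noteq> v"
  obtains V1 V2 w where "V = V1 \<union> V2" "V1 \<inter> V2 = {}" "connected_in E V1" "connected_in E V2"
    "u \<in> V1" "v \<in> V2" "w \<in> V2" "(u, w) \<in> E"
proof -
  define D where "D = E \<inter> (V - {u}) \<times> (V - {u})"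
  define V2 where "V2 = {x. (v, x) \<in> D\<^sup>*}"
  define V1 where "V1 = V - V2"
  have sym_D: "sym D" using \<open>sym E\<close> unfolding D_def sym_def by blast
  have V2_sub: "x \<in> V - {u}" if "(v, x) \<in> D\<^sup>*" for x
    using that assms by (induction rule: rtrancl_induct) (auto simp: D_def)
  \<comment> \<open>Within \<open>V\<close>, an edge between \<open>V2\<close> and its complement
    has \<open>u\<close> as its end outside \<open>V2\<close>.\<close>
  have absorb: "x \<in> V2" if "y \<in> V2" "x \<in> V" "x \<noteq> u" "(x, y) \<in> E" for x y
  proof -
    have "(x, y) \<in> D" using that V2_sub unfolding V2_def D_def by blast
    then have "(y, x) \<in> D" using sym_D by (rule symD[rotated])
    then show ?thesis using that unfolding V2_def by auto
  qed
  have v2: "v \<in> V2" unfolding V2_def by simp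
  have u1: "u \<in> V1" using V2_sub assms unfolding V1_def V2_def by blast
  have from_v: "(v, x) \<in> (E \<inter> V2 \<times> V2)\<^sup>*" if "(v, x) \<in> D\<^sup>*" for x
    using that
  proof (induction rule: rtrancl_induct)
    case (step y z)
    then have "(y, z) \<in> E \<inter> V2 \<times> V2" unfolding V2_def D_def by (auto intro: rtrancl_into_rtrancl)
    with step.IH show ?case by (rule rtrancl_into_rtrancl)
  qed simp
  have sym2: "sym ((E \<inter> V2 \<times> V2)\<^sup>*)"
    by (rule sym_rtrancl) (use \<open>sym E\<close> in \<open>auto simp: sym_def\<close>)
  have c2: "connected_in E V2"
    unfolding connected_in_def
  proof (intro ballI)
    fix x y assume "x \<in> V2" "y \<in> V2"
    then have "(v, x) \<in> (E \<inter> V2 \<times> V2)\<^sup>*" "(v, y) \<in> (E \<inter> V2 \<times> V2)\<^sup>*"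
      using from_v unfolding V2_def by auto
    then show "(x, y) \<in> (E \<inter> V2 \<times> V2)\<^sup>*"
      using sym2 by (meson rtrancl_trans symD)
  qed
  \<comment> \<open>By \<open>absorb\<close>, a walk to \<open>u\<close> that starts in
    \<open>V1\<close> cannot enter \<open>V2\<close> before it meets \<open>u\<close>.\<close>
  have to_u: "x \<in> V1 \<longrightarrow> (x, u) \<in> (E \<inter> V1 \<times> V1)\<^sup>*" if "(x, u) \<in> (E \<inter> V \<times> V)\<^sup>*" for x
    using that
  proof (induction rule: converse_rtrancl_induct)
    case (step x y)
    show ?case
    proof
      assume x: "x \<in> V1"
      show "(x, u) \<in> (E \<inter> V1 \<times> V1)\<^sup>*"
      proof (cases "x = u")
        case False
        then have "y \<in> V1" using absorb[of y x] x step.hyps unfolding V1_def by blast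
        then show ?thesis using x step by (auto intro: converse_rtrancl_into_rtrancl)
      qed simp
    qed
  qed simp
  have sym1: "sym ((E \<inter> V1 \<times> V1)\<^sup>*)"
    by (rule sym_rtrancl) (use \<open>sym E\<close> in \<open>auto simp: sym_def\<close>)
  have c1: "connected_in E V1"
    unfolding connected_in_def
  proof (intro ballI)
    fix x y assume xy: "x \<in> V1" "y \<in> V1"
    then have "(x, u) \<in> (E \<inter> V \<times> V)\<^sup>*" "(y, u) \<in> (E \<inter> V \<times> V)\<^sup>*"
      using assms unfolding V1_def connected_in_def by auto
    then have "(x, u) \<in> (E \<inter> V1 \<times> V1)\<^sup>*" "(y, u) \<in> (E \<inter> V1 \<times> V1)\<^sup>*"
      using to_u xy by auto
    then show "(x, y) \<in> (E \<inter> V1 \<times> V1)\<^sup>*"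
      using sym1 by (meson rtrancl_trans symD)
  qed
  \<comment> \<open>On a walk from \<open>u\<close> to \<open>v\<close>, a step that enters
    \<open>V2\<close> starts at \<open>u\<close>, again by \<open>absorb\<close>; its end serves as
    \<open>w\<close>.\<close>
  have "(u, v) \<in> (E \<inter> V \<times> V)\<^sup>*" using assms unfolding connected_in_def by blast
  then have "v \<in> V2 \<longrightarrow> (\<exists>w\<in>V2. (u, w) \<in> E)"
  proof (induction rule: rtrancl_induct)
    case base
    then show ?case using u1 unfolding V1_def by blast
  next
    case (step y z)
    then show ?case using absorb by blast
  qed
  then obtain w where "w \<in> V2" "(u, w) \<in> E" using v2 by blast
  moreover have "V = V1 \<union> V2" "V1 \<inter> V2 = {}" using V2_sub unfolding V1_def V2_def by auto
  ultimately show thesis using that c1 c2 u1 v2 by blast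
qed

text \<open>Smaller than the usual cube of a graph in that one of the three steps is never idle.\<close>

abbreviation cube :: "('v \<times> 'v) set \<Rightarrow> ('v \<times> 'v) set" where
  "cube E \<equiv> E\<^sup>= O E O E\<^sup>="

lemma sym_cube: "sym E \<Longrightarrow> sym (cube E)"
  unfolding sym_def by blast

text \<open>Sekanina's theorem, by induction on \<open>card V\<close>. Split off the part of
  \<open>v\<close> along an edge from \<open>u\<close> to \<open>w\<close>. A Hamiltonian path of
  the part of \<open>u\<close> that stops at or next to \<open>u\<close> is joined to one of the
  part of \<open>v\<close> that starts at or next to \<open>w\<close>.\<close>

lemma ham_path_cube:
  assumes "sym E" "finite V" "connected_in E V" "u \<in> V" "v \<in> V" "u \<noteq> v"
  shows "\<exists>p. ham_path (cube E) V u v p"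
  using assms(2-)
proof (induction "card V" arbitrary: V u v rule: less_induct)
  case less
  obtain V1 V2 w where V: "V = V1 \<union> V2" "V1 \<inter> V2 = {}" "connected_in E V1" "connected_in E V2"
    "u \<in> V1" "v \<in> V2" "w \<in> V2" "(u, w) \<in> E"
    using connected_in_split[OF \<open>sym E\<close> less.prems(2-5)] .
  have fin: "finite V1" "finite V2" using V less.prems by auto
  have "V1 \<subset> V" "V2 \<subset> V" using V by auto
  then have card: "card V1 < card V" "card V2 < card V"
    using less.prems(1) by (auto intro: psubset_card_mono)
  \<comment> \<open>A singleton gives the one-point path with \<open>x' = x\<close>; otherwise the
    induction hypothesis is applied with a neighbour of \<open>x\<close> as end.\<close>
  have near: "\<exists>x'\<in>W. (x, x') \<in> E\<^sup>= \<and> (\<exists>p. ham_path (cube E) W x x' p)"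
    if W: "finite W" "card W < card V" "connected_in E W" "x \<in> W" for W x
  proof (cases "W = {x}")
    case True
    then have "ham_path (cube E) W x x [x]" by (simp add: ham_path_def)
    then show ?thesis using W by auto
  next
    case False
    then obtain y where "y \<in> W" "x \<noteq> y" using W by auto
    then obtain x' where "x' \<in> W" "x' \<noteq> x" "(x, x') \<in> E"
      using connected_in_neighbour[of E W x y] W by blast
    then show ?thesis using less.hyps[of W x x'] W by blast
  qed
  obtain u' p where u': "u' \<in> V1" "(u, u') \<in> E\<^sup>=" and p: "ham_path (cube E) V1 u u' p"
    using near[of V1 u] fin card V by blast
  \<comment> \<open>If \<open>w = v\<close>, the edge arrives where the path has to end, so a path
    from \<open>v\<close> to a nearby \<open>w'\<close> is reversed; otherwise \<open>w' = w\<close>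
    works.\<close>
  obtain w' q where w': "w' \<in> V2" "(w, w') \<in> E\<^sup>=" and q: "ham_path (cube E) V2 w' v q"
  proof (cases "w = v")
    case True
    obtain w' q where "w' \<in> V2" "(w, w') \<in> E\<^sup>=" "ham_path (cube E) V2 w w' q"
      using near[of V2 w] fin card V by blast
    then show thesis
      using that[of w' "rev q"] ham_path_rev[OF _ sym_cube[OF \<open>sym E\<close>]] True by blast
  next
    case False
    then show thesis using that[of w] less.hyps[of V2 w v] fin card V by blast
  qed
  \<comment> \<open>The jump runs from \<open>u'\<close> through \<open>u\<close> and
    \<open>w\<close> to \<open>w'\<close>; only its middle step is sure to be an edge.\<close>
  have "(u', w') \<in> cube E"
    using u' w' V(8) symD[OF \<open>sym E\<close>] by blast
  then show ?case
    using ham_path_append[OF p q V(2)] V(1) by blast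
qed

section \<open>Words and balls in a group\<close>

lemma word_prod_Nil [simp]: "word_prod G [] = \<one>\<^bsub>G\<^esub>"
  by (simp add: word_prod_def)

lemma word_prod_Cons [simp]: "word_prod G (x # w) = x \<otimes>\<^bsub>G\<^esub> word_prod G w"
  by (simp add: word_prod_def)

lemma word_length_le: "w \<in> lists S \<Longrightarrow> word_length G S (word_prod G w) \<le> length w"
  unfolding word_length_def by (rule Least_le) auto

lemma word_length_witness:
  assumes "w \<in> lists S" "word_prod G w = g"
  obtains v where "v \<in> lists S" "word_prod G v = g" "length v = word_length G S g"
proof -
  have "\<exists>v\<in>lists S. length v = word_length G S g \<and> word_prod G v = g"
    unfolding word_length_def by (rule LeastI_ex) (use assms in auto)
  then show thesis using that by blast
qed

context group
begin

lemma word_prod_closed: "S \<subseteq> carrier G \<Longrightarrow> w \<in> lists S \<Longrightarrow> word_prod G w \<in> carrier G"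
  by (induction w) auto

lemma word_prod_append:
  assumes "S \<subseteq> carrier G" "v \<in> lists S" "w \<in> lists S"
  shows "word_prod G (v @ w) = word_prod G v \<otimes> word_prod G w"
  using assms(2) assms(1,3)
  by (induction v) (auto simp: m_assoc word_prod_closed[OF assms(1)] subset_iff)

lemma word_prod_inv:
  assumes "S \<subseteq> carrier G" "\<forall>s\<in>S. inv s \<in> S" "w \<in> lists S"
  shows "word_prod G (rev (map (m_inv G) w)) = inv (word_prod G w)"
  using assms(3)
proof (induction w)
  case (Cons s w)
  have "rev (map (m_inv G) w) \<in> lists S" using Cons assms(2) by auto
  then show ?case
    using Cons assms word_prod_closed[OF assms(1)]
    by (simp add: word_prod_append[OF assms(1)] inv_mult_group subset_iff)
qed simp

lemma sym_gen_set_word: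
  assumes "sym_gen_set G S" "g \<in> carrier G"
  obtains w where "w \<in> lists S" "word_prod G w = g"
proof -
  have S: "S \<subseteq> carrier G" "\<forall>s\<in>S. inv s \<in> S" "generate G S = carrier G"
    using assms(1) by (auto simp: sym_gen_set_def)
  have "g \<in> generate G S" using S assms by simp
  then have "\<exists>w\<in>lists S. word_prod G w = g"
  proof (induction rule: generate.induct)
    case one
    show ?case by (rule bexI[of _ "[]"]) auto
  next
    case (incl h)
    then show ?case using S by (intro bexI[of _ "[h]"]) auto
  next
    case (inv h)
    then show ?case using S by (intro bexI[of _ "[inv h]"]) auto
  next
    case (eng g h)
    then obtain v w where vw: "v \<in> lists S" "word_prod G v = g" "w \<in> lists S" "word_prod G w = h"
      by blast
    show ?case
      using vw word_prod_append[OF S(1) vw(1,3)] by (intro bexI[of _ "v @ w"]) auto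
  qed
  then show thesis using that by blast
qed

lemma word_length_one [simp]: "word_length G S \<one> = 0"
  using word_length_le[of "[]" S G] by simp

lemma word_length_mult_generator:
  assumes "sym_gen_set G S" "g \<in> carrier G" "s \<in> S"
  shows "word_length G S (g \<otimes> s) \<le> word_length G S g + 1"
proof -
  have S: "S \<subseteq> carrier G" using assms by (auto simp: sym_gen_set_def)
  obtain w where "w \<in> lists S" "word_prod G w = g"
    using sym_gen_set_word[OF assms(1,2)] .
  then obtain v where v: "v \<in> lists S" "word_prod G v = g" "length v = word_length G S g"
    by (rule word_length_witness)
  then have "word_prod G (v @ [s]) = g \<otimes> s"
    using word_prod_append[OF S, of v "[s]"] S assms by (auto simp: subset_iff)
  then show ?thesis
    using word_length_le[of "v @ [s]" S G] v assms by simp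
qed

lemma word_length_eq_0:
  assumes "sym_gen_set G S" "g \<in> carrier G" "word_length G S g = 0"
  shows "g = \<one>"
proof -
  obtain w where "w \<in> lists S" "word_prod G w = g" using sym_gen_set_word[OF assms(1,2)] .
  then obtain v where "v \<in> lists S" "word_prod G v = g" "length v = word_length G S g"
    by (rule word_length_witness)
  then show ?thesis using assms(3) by simp
qed

text \<open>If the identity were a dead end, every generator would have length 0. Nontriviality of
  the lamp value later forces the cursor to visit every point of \<open>F\<close>.\<close>

lemma dead_end_nontrivial:
  assumes "sym_gen_set G S" "carrier G \<noteq> {\<one>}" "dead_end G S g"
  shows "g \<noteq> \<one>"
proof
  assume g: "g = \<one>"
  have S: "S \<subseteq> carrier G" "generate G S = carrier G"
    using assms(1) by (auto simp: sym_gen_set_def)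
  have "s = \<one>" if "s \<in> S" for s
  proof -
    have "word_length G S s = 0"
      using assms(3) that S g unfolding dead_end_def by (auto simp: subset_iff)
    then show ?thesis using word_length_eq_0[OF assms(1)] that S by blast
  qed
  then have "S \<subseteq> {\<one>}" by blast
  then have "generate G S \<subseteq> {\<one>}"
    using mono_generate generate_one by blast
  then show False using S assms(2) by auto
qed

section \<open>Balls of products of short words\<close>

definition ball :: "'a set \<Rightarrow> nat \<Rightarrow> 'a set" where
  "ball T k = word_prod G ` {w \<in> lists T. length w \<le> k}"

lemma ballI: "w \<in> lists T \<Longrightarrow> length w \<le> k \<Longrightarrow> word_prod G w \<in> ball T k"
  by (auto simp: ball_def)

lemma ballE:
  assumes "g \<in> ball T k"
  obtains w where "w \<in> lists T" "length w \<le> k" "g = word_prod G w"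
  using assms by (auto simp: ball_def)

lemma finite_ball: "finite T \<Longrightarrow> finite (ball T k)"
  unfolding ball_def by (rule finite_imageI) (simp add: lists_eq_set finite_lists_length_le)

lemma ball_mono: "j \<le> k \<Longrightarrow> ball T j \<subseteq> ball T k"
  by (auto simp: ball_def)

lemma one_in_ball [simp]: "\<one> \<in> ball T k"
  using ballI[of "[]"] by simp

lemma ball_subset_carrier: "T \<subseteq> carrier G \<Longrightarrow> ball T k \<subseteq> carrier G"
  using word_prod_closed by (auto elim!: ballE)

lemma subset_ball: "T \<subseteq> carrier G \<Longrightarrow> 1 \<le> k \<Longrightarrow> T \<subseteq> ball T k"
  using ballI[of "[t]" T k for t] by fastforce

lemma ball_mult:
  assumes "T \<subseteq> carrier G" "g \<in> ball T j" "h \<in> ball T k"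
  shows "g \<otimes> h \<in> ball T (j + k)"
proof -
  obtain v w where "v \<in> lists T" "length v \<le> j" "g = word_prod G v"
    "w \<in> lists T" "length w \<le> k" "h = word_prod G w"
    using assms by (meson ballE)
  then show ?thesis
    using ballI[of "v @ w" T "j + k"] word_prod_append[OF assms(1)] by auto
qed

text \<open>Each letter is spelled out over \<open>T\<close>. With \<open>j = 3\<close> this
  explains the radius \<open>3 * k\<close> of the set \<open>F\<close> in the theorem.\<close>

lemma ball_ball:
  assumes "T \<subseteq> carrier G"
  shows "ball (ball T j) k \<subseteq> ball T (j * k)"
proof
  fix g assume "g \<in> ball (ball T j) k"
  then obtain w where w: "w \<in> lists (ball T j)" "length w \<le> k" "g = word_prod G w"
    by (rule ballE)
  from w(1) have "word_prod G w \<in> ball T (j * length w)"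
  proof (induction w)
    case (Cons h w)
    then show ?case using ball_mult[OF assms, of h j] by simp
  qed simp
  then show "g \<in> ball T (j * k)"
    using w ball_mono[of "j * length w" "j * k"] by auto
qed

lemma sym_gen_set_ball:
  assumes "sym_gen_set G T" "1 \<le> k"
  shows "sym_gen_set G (ball T k)"
proof -
  have T: "finite T" "T \<subseteq> carrier G" "\<forall>t\<in>T. inv t \<in> T" "generate G T = carrier G"
    using assms by (auto simp: sym_gen_set_def)
  have "inv g \<in> ball T k" if "g \<in> ball T k" for g
    using that
  proof (rule ballE)
    fix w assume w: "w \<in> lists T" "length w \<le> k" "g = word_prod G w"
    have "rev (map (m_inv G) w) \<in> lists T" using w T(3) by auto
    then have "word_prod G (rev (map (m_inv G) w)) \<in> ball T k" using w by (intro ballI) auto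
    then show ?thesis using word_prod_inv[OF T(2,3) w(1)] w by simp
  qed
  moreover have "generate G (ball T k) = carrier G"
    using mono_generate[OF subset_ball[OF T(2) assms(2)]] generate_incl[OF ball_subset_carrier[OF T(2)]]
      T(4) by blast
  ultimately show ?thesis
    using T finite_ball ball_subset_carrier by (auto simp: sym_gen_set_def)
qed

lemma fin_gen_sym_gen_set:
  assumes "fin_gen G"
  obtains T where "sym_gen_set G T"
proof -
  obtain T where T: "finite T" "T \<subseteq> carrier G" "generate G T = carrier G"
    using assms by (auto simp: fin_gen_def)
  let ?T = "T \<union> m_inv G ` T"
  have sub: "?T \<subseteq> carrier G" using T by auto
  then have "generate G ?T = carrier G"
    using mono_generate[of T ?T] generate_incl[OF sub] T by blast
  then have "sym_gen_set G ?T"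
    using T sub by (auto simp: sym_gen_set_def subset_iff)
  then show thesis using that by blast
qed

section \<open>Cayley graphs and their balls\<close>

text \<open>Edges lead from \<open>x\<close> to \<open>x \<otimes> t\<close>: right multiplication,
  which is how the cursor moves in the wreath product.\<close>

definition cayley :: "'a set \<Rightarrow> ('a \<times> 'a) set" where
  "cayley T = {(x, y). x \<in> carrier G \<and> y \<in> carrier G \<and> inv x \<otimes> y \<in> T}"

lemma sym_cayley:
  assumes "\<forall>t\<in>T. inv t \<in> T"
  shows "sym (cayley T)"
proof (rule symI)
  fix x y assume xy: "(x, y) \<in> cayley T"
  then have "inv (inv x \<otimes> y) \<in> T" using assms by (auto simp: cayley_def)
  then show "(y, x) \<in> cayley T" using xy by (auto simp: cayley_def inv_mult_group)
qed

text \<open>The prefixes of a word of length at most \<open>k\<close> stay in the ball and form a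
  walk from \<open>\<one>\<close> to its product.\<close>

lemma connected_in_ball:
  assumes "T \<subseteq> carrier G" "\<forall>t\<in>T. inv t \<in> T"
  shows "connected_in (cayley T) (ball T k)"
proof -
  let ?E = "cayley T \<inter> ball T k \<times> ball T k"
  have from_one: "(\<one>, word_prod G w) \<in> ?E\<^sup>*" if "w \<in> lists T" "length w \<le> k" for w
    using that
  proof (induction w rule: rev_induct)
    case (snoc t w)
    have prod: "word_prod G (w @ [t]) = word_prod G w \<otimes> t"
      using word_prod_append[OF assms(1), of w "[t]"] snoc.prems assms(1) by (auto simp: subset_iff)
    have "(word_prod G w, word_prod G (w @ [t])) \<in> cayley T"
      using snoc.prems assms(1) word_prod_closed[OF assms(1), of w]
      unfolding prod by (auto simp: cayley_def subset_iff simp flip: m_assoc)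
    moreover have "word_prod G w \<in> ball T k" "word_prod G (w @ [t]) \<in> ball T k"
      using snoc.prems by (auto intro!: ballI)
    ultimately show ?case using snoc by (auto intro: rtrancl_into_rtrancl)
  qed simp
  have "sym (?E\<^sup>*)"
    by (rule sym_rtrancl) (use sym_cayley[OF assms(2)] in \<open>auto simp: sym_def\<close>)
  moreover have "(\<one>, x) \<in> ?E\<^sup>*" if "x \<in> ball T k" for x
    using that from_one by (auto elim!: ballE)
  ultimately show ?thesis
    unfolding connected_in_def by (blast intro: rtrancl_trans dest: symD)
qed

lemma cayley_relcomp:
  assumes "(x, y) \<in> cayley S" "(y, z) \<in> cayley T" "\<And>s t. s \<in> S \<Longrightarrow> t \<in> T \<Longrightarrow> s \<otimes> t \<in> U"
  shows "(x, z) \<in> cayley U"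
proof -
  have xyz: "x \<in> carrier G" "y \<in> carrier G" "z \<in> carrier G"
    using assms by (auto simp: cayley_def)
  then have "y \<otimes> (inv y \<otimes> z) = z" by (simp flip: m_assoc)
  then have "inv x \<otimes> z = (inv x \<otimes> y) \<otimes> (inv y \<otimes> z)"
    using xyz by (simp add: m_assoc)
  also have "\<dots> \<in> U"
    using assms by (intro assms(3)) (auto simp: cayley_def)
  finally show ?thesis using xyz by (simp add: cayley_def)
qed

lemma cayley_Id_subset_ball:
  assumes "T \<subseteq> carrier G" "(x, y) \<in> (cayley T)\<^sup>=" "x \<in> carrier G"
  shows "(x, y) \<in> cayley (ball T 1)"
  using assms subset_ball[OF assms(1), of 1] by (auto simp: cayley_def)

text \<open>Each of the three steps costs at most one letter of \<open>T\<close>, whence the radius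
  3 of \<open>S_B\<close>.\<close>

lemma cube_cayley:
  assumes "T \<subseteq> carrier G"
  shows "cube (cayley T) \<subseteq> cayley (ball T 3)"
proof clarify
  fix x y z u assume "(x, y) \<in> (cayley T)\<^sup>=" "(y, z) \<in> cayley T" "(z, u) \<in> (cayley T)\<^sup>="
  \<comment> \<open>Since the middle step is a genuine edge, an idle outer step also happens inside
    the carrier.\<close>
  moreover from this have "x \<in> carrier G" "y \<in> carrier G" "z \<in> carrier G"
    by (auto simp: cayley_def)
  ultimately have *: "(x, y) \<in> cayley (ball T 1)" "(y, z) \<in> cayley (ball T 1)"
    "(z, u) \<in> cayley (ball T 1)"
    using cayley_Id_subset_ball[OF assms] by blast+
  have "(x, z) \<in> cayley (ball T 2)"
    using cayley_relcomp[OF *(1,2)] ball_mult[OF assms, of _ 1 _ 1] by (simp add: numeral_2_eq_2)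
  from cayley_relcomp[OF this *(3)] show "(x, u) \<in> cayley (ball T 3)"
    using ball_mult[OF assms, of _ 2 _ 1] by simp
qed

end

text \<open>If a word \<open>w\<close> with at most \<open>n\<close> letters led to a longer
  element, every member of the set in \<open>depth\<close> would be below \<open>length w\<close>,
  so the supremum would be at most \<open>n - 1\<close>, which is less than \<open>n\<close> because
  \<open>n \<ge> 1\<close>.\<close>

lemma depth_geD:
  assumes "depth G S g \<ge> enat n" "n \<ge> 1" "w \<in> lists S" "length w \<le> n"
  shows "word_length G S (g \<otimes>\<^bsub>G\<^esub> word_prod G w) \<le> word_length G S g"
proof (rule ccontr)
  assume neg: "\<not> ?thesis"
  have "depth G S g \<le> enat (n - 1)"
    unfolding depth_def
  proof (rule Sup_least, clarify)
    fix m assume "\<forall>w\<in>lists S. length w \<le> m \<longrightarrow>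
      word_length G S (g \<otimes>\<^bsub>G\<^esub> word_prod G w) \<le> word_length G S g"
    then have "\<not> length w \<le> m" using neg assms(3) by blast
    then show "enat m \<le> enat (n - 1)" using assms(4) by simp
  qed
  with assms(1) have "enat n \<le> enat (n - 1)" by (rule order_trans)
  then show False using assms(2) by simp
qed

lemma depth_geI:
  assumes "n \<ge> 1" "\<And>w. w \<in> lists S \<Longrightarrow> length w \<le> n \<Longrightarrow>
      word_length G S (g \<otimes>\<^bsub>G\<^esub> word_prod G w) \<le> word_length G S g"
  shows "enat n \<le> depth G S g"
  unfolding depth_def by (rule Sup_upper) (use assms in auto)

section \<open>Word length in wreath products\<close>

lemma word_prod_hom:
  assumes "h \<in> hom G H" "group G" "group H" "w \<in> lists (carrier G)"
  shows "word_prod H (map h w) = h (word_prod G w)"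
proof -
  interpret G: group G by fact
  have "h \<one>\<^bsub>G\<^esub> = \<one>\<^bsub>H\<^esub>" using hom_one[OF assms(1-3)] .
  then show ?thesis
    using assms(4) by (induction w) (auto simp: hom_mult[OF assms(1)] G.word_prod_closed[OF subset_refl])
qed

locale wreath_gens = A: group A + B: group B
  for A :: "('a, 'c) monoid_scheme" and B :: "('b, 'd) monoid_scheme" +
  fixes S_A :: "'a set" and S_B :: "'b set"
  assumes S_A: "sym_gen_set A S_A" and S_B: "sym_gen_set B S_B"
begin

abbreviation "W \<equiv> wreath A B"
abbreviation "S \<equiv> embed_base A B ` S_A \<union> embed_top A B ` S_B"
abbreviation "len \<equiv> word_length A S_A"

sublocale W: group W
  by (rule group_wreath) (rule A.is_group B.is_group)+

lemma S_A_carrier: "S_A \<subseteq> carrier A" and S_B_carrier: "S_B \<subseteq> carrier B"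
  using S_A S_B by (auto simp: sym_gen_set_def)

lemma carrier_iff: "(f, b) \<in> carrier W \<longleftrightarrow>
    f \<in> carrier B \<rightarrow>\<^sub>E carrier A \<and> finite {x \<in> carrier B. f x \<noteq> \<one>\<^bsub>A\<^esub>} \<and> b \<in> carrier B"
  by (rule wreath_carrier_iff) (rule A.is_group)

lemma S_carrier: "S \<subseteq> carrier W"
  using hom_in_carrier[OF embed_base_hom(1)[OF A.is_group B.is_group]]
    hom_in_carrier[OF embed_top_hom(1)[OF A.is_group B.is_group]] S_A_carrier S_B_carrier
  by blast

text \<open>The shift by \<open>b\<close> carries the single lamp of \<open>a\<close> from the
  identity to the cursor, so only the lamp under the cursor changes.\<close>

lemma mult_embed_base:
  assumes "(f, b) \<in> carrier W" "a \<in> carrier A"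
  shows "(f, b) \<otimes>\<^bsub>W\<^esub> embed_base A B a = (f(b := f b \<otimes>\<^bsub>A\<^esub> a), b)"
proof -
  have f: "f \<in> carrier B \<rightarrow>\<^sub>E carrier A" and b: "b \<in> carrier B"
    using assms(1) by (auto simp: carrier_iff)
  have "inv\<^bsub>B\<^esub> b \<otimes>\<^bsub>B\<^esub> x = \<one>\<^bsub>B\<^esub> \<longleftrightarrow> x = b" if "x \<in> carrier B" for x
    using b that by (metis B.inv_closed B.inv_equality B.inv_inv B.l_inv)
  then have "f \<otimes>\<^bsub>base_group A B\<^esub> shift B b (fst (embed_base A B a)) = f(b := f b \<otimes>\<^bsub>A\<^esub> a)"
    using f b assms(2) PiE_arb[OF f]
    by (auto simp: fun_eq_iff embed_base_def shift_def restrict_def PiE_iff)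
  then show ?thesis
    using b by (simp add: wreath_def embed_base_def)
qed

lemma mult_embed_top:
  assumes "(f, b) \<in> carrier W"
  shows "(f, b) \<otimes>\<^bsub>W\<^esub> embed_top A B s = (f, b \<otimes>\<^bsub>B\<^esub> s)"
proof -
  have f: "f \<in> carrier B \<rightarrow>\<^sub>E carrier A" and b: "b \<in> carrier B"
    using assms by (auto simp: carrier_iff)
  have "f \<otimes>\<^bsub>base_group A B\<^esub> shift B b \<one>\<^bsub>base_group A B\<^esub> = f"
    using f b PiE_arb[OF f] by (auto simp: fun_eq_iff shift_def restrict_def PiE_iff)
  then show ?thesis
    by (simp add: wreath_def embed_top_def)
qed

lemma upd_carrier:
  assumes "(f, b) \<in> carrier W" "x \<in> carrier B" "a \<in> carrier A" "b' \<in> carrier B"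
  shows "(f(x := a), b') \<in> carrier W"
proof -
  have "{y \<in> carrier B. (f(x := a)) y \<noteq> \<one>\<^bsub>A\<^esub>} \<subseteq> insert x {y \<in> carrier B. f y \<noteq> \<one>\<^bsub>A\<^esub>}"
    by auto
  then have "finite {y \<in> carrier B. (f(x := a)) y \<noteq> \<one>\<^bsub>A\<^esub>}"
    by (rule finite_subset) (use assms(1) in \<open>simp add: carrier_iff\<close>)
  then show ?thesis
    using assms by (auto simp: carrier_iff PiE_iff extensional_def)
qed

section \<open>Upper bounds: writing lamps along a path\<close>

text \<open>Hides words behind their lengths, which add up when words are concatenated.\<close>

definition reach :: "('b \<Rightarrow> 'a) \<times> 'b \<Rightarrow> nat \<Rightarrow> ('b \<Rightarrow> 'a) \<times> 'b \<Rightarrow> bool" where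
  "reach g n h \<longleftrightarrow> (\<exists>w\<in>lists S. length w = n \<and> g \<otimes>\<^bsub>W\<^esub> word_prod W w = h)"

lemma reach_trans:
  assumes "g \<in> carrier W" "reach g m h" "reach h n k"
  shows "reach g (m + n) k"
proof -
  obtain v w where vw: "v \<in> lists S" "length v = m" "g \<otimes>\<^bsub>W\<^esub> word_prod W v = h"
      "w \<in> lists S" "length w = n" "h \<otimes>\<^bsub>W\<^esub> word_prod W w = k"
    using assms by (auto simp: reach_def)
  then have "g \<otimes>\<^bsub>W\<^esub> word_prod W (v @ w) = k"
    using assms(1) W.word_prod_append[OF S_carrier] W.word_prod_closed[OF S_carrier]
    by (metis W.m_assoc)
  moreover have "v @ w \<in> lists S" using vw by auto
  ultimately show ?thesis unfolding reach_def using vw by (metis length_append)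
qed

lemma reach_base:
  assumes "(f, b) \<in> carrier W" "a \<in> carrier A"
  shows "reach (f, b) (len a) (f(b := f b \<otimes>\<^bsub>A\<^esub> a), b)"
proof -
  obtain w where "w \<in> lists S_A" "word_prod A w = a"
    using A.sym_gen_set_word[OF S_A assms(2)] .
  then obtain v where v: "v \<in> lists S_A" "word_prod A v = a" "length v = len a"
    by (rule word_length_witness)
  have "word_prod W (map (embed_base A B) v) = embed_base A B a"
    using word_prod_hom[OF embed_base_hom(1)[OF A.is_group B.is_group] A.is_group W.is_group, of v]
      v S_A_carrier by auto
  moreover have "map (embed_base A B) v \<in> lists S" using v by auto
  ultimately show ?thesis
    using mult_embed_base[OF assms] v(3) by (auto simp: reach_def intro!: bexI)
qed

lemma reach_top:
  assumes "(f, b) \<in> carrier W" "(b, b') \<in> B.cayley S_B"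
  shows "reach (f, b) 1 (f, b')"
proof -
  let ?s = "inv\<^bsub>B\<^esub> b \<otimes>\<^bsub>B\<^esub> b'"
  have s: "?s \<in> S_B" "b \<in> carrier B" "b' \<in> carrier B"
    using assms(2) by (auto simp: B.cayley_def)
  then have "b \<otimes>\<^bsub>B\<^esub> ?s = b'" by (simp flip: B.m_assoc)
  moreover have "embed_top A B ?s \<in> carrier W" using s S_carrier by blast
  ultimately have "(f, b) \<otimes>\<^bsub>W\<^esub> word_prod W [embed_top A B ?s] = (f, b')"
    using mult_embed_top[OF assms(1)] by simp
  then show ?thesis
    unfolding reach_def using s(1) by (intro bexI[of _ "[embed_top A B ?s]"]) auto
qed

text \<open>Walk along \<open>p\<close> and write the lamp \<open>f' x\<close> on arrival at
  \<open>x\<close>. The lamps on \<open>p\<close> start trivial, so that multiplying by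
  \<open>f' x\<close> writes this value; \<open>length p - 1\<close> moves join the
  vertices.\<close>

lemma reach_along_path:
  assumes "p \<noteq> []" "distinct p" "successively (\<lambda>x y. (x, y) \<in> B.cayley S_B) p"
    and "(f, hd p) \<in> carrier W" "set p \<subseteq> carrier B"
    and "\<And>x. x \<in> set p \<Longrightarrow> f x = \<one>\<^bsub>A\<^esub>" "\<And>x. x \<in> set p \<Longrightarrow> f' x \<in> carrier A"
    and "\<And>x. x \<notin> set p \<Longrightarrow> f' x = f x"
  shows "reach (f, hd p) ((\<Sum>x\<in>set p. len (f' x)) + (length p - 1)) (f', last p)"
  using assms
proof (induction p arbitrary: f)
  case (Cons x q)
  let ?g = "f(x := f' x)"
  have x: "(f, x) \<in> carrier W" "f' x \<in> carrier A" "f x = \<one>\<^bsub>A\<^esub>" "x \<in> carrier B"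
    using Cons.prems by auto
  then have at_x: "reach (f, x) (len (f' x)) (?g, x)"
    using reach_base[of f x "f' x"] by simp
  show ?case
  proof (cases q)
    case Nil
    then have "f' = ?g" using Cons.prems(8) by auto
    then have "reach (f, x) (len (f' x)) (f', x)" using at_x by simp
    then show ?thesis using Nil by simp
  next
    case (Cons y r)
    have edge: "(x, y) \<in> B.cayley S_B" and y: "y \<in> carrier B"
      using Cons.prems(3,5) Cons by auto
    have g: "(?g, x) \<in> carrier W" "(?g, hd q) \<in> carrier W"
      using upd_carrier[OF x(1)] x y Cons by auto
    \<comment> \<open>As \<open>p\<close> is distinct, writing at \<open>x\<close> leaves the lamps
      on \<open>q\<close> trivial, and off \<open>q\<close> the goal \<open>f'\<close> now agrees
      with \<open>?g\<close>.\<close>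
    have "reach (?g, hd q) ((\<Sum>x\<in>set q. len (f' x)) + (length q - 1)) (f', last q)"
    proof (rule Cons.IH)
      show "successively (\<lambda>x y. (x, y) \<in> B.cayley S_B) q"
        using Cons.prems(3) Cons by (simp add: successively_Cons)
      show "(?g, hd q) \<in> carrier W" by (rule g)
    qed (use Cons.prems Cons in \<open>auto\<close>)
    moreover have "reach (?g, x) 1 (?g, hd q)" using reach_top[OF g(1) edge] Cons by simp
    ultimately have "reach (f, x) (len (f' x) + (1 + ((\<Sum>x\<in>set q. len (f' x)) + (length q - 1))))
        (f', last q)"
      using reach_trans g(1) x(1) at_x by blast
    moreover have "(\<Sum>x\<in>set (x # q). len (f' x)) = len (f' x) + (\<Sum>x\<in>set q. len (f' x))"
      using Cons.prems(2) by simp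
    ultimately show ?thesis using Cons by (simp add: algebra_simps)
  qed
qed simp

lemma word_length_le_reach:
  assumes "reach \<one>\<^bsub>W\<^esub> n g" "g \<in> carrier W"
  shows "word_length W S g \<le> n"
proof -
  obtain w where w: "w \<in> lists S" "length w = n" "\<one>\<^bsub>W\<^esub> \<otimes>\<^bsub>W\<^esub> word_prod W w = g"
    using assms(1) by (auto simp: reach_def)
  then have "word_prod W w = g"
    using W.word_prod_closed[OF S_carrier w(1)] by simp
  then show ?thesis using word_length_le[OF w(1)] w(2) by metis
qed

section \<open>Tracking cursor and lamps letter by letter\<close>

lemma word_prod_snoc:
  "w \<in> lists S \<Longrightarrow> s \<in> S \<Longrightarrow> word_prod W (w @ [s]) = word_prod W w \<otimes>\<^bsub>W\<^esub> s"
  using W.word_prod_append[OF S_carrier, of w "[s]"] S_carrier by auto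

text \<open>The list \<open>p\<close> records the positions after the letters from \<open>S_B\<close>, and \<open>m\<close> counts the letters
  from \<open>S_A\<close>.\<close>

lemma word_decomposition:
  assumes "w \<in> lists S" "word_prod W w = (f, b)"
  shows "\<exists>p m. length w = length p + m \<and> last (\<one>\<^bsub>B\<^esub> # p) = b \<and>
    {x \<in> carrier B. f x \<noteq> \<one>\<^bsub>A\<^esub>} \<subseteq> set (\<one>\<^bsub>B\<^esub> # p) \<and>
    (\<forall>F. finite F \<longrightarrow> F \<subseteq> carrier B \<longrightarrow> (\<Sum>x\<in>F. len (f x)) \<le> m)"
  using assms
proof (induction w arbitrary: f b rule: rev_induct)
  case Nil
  have "f = (\<lambda>x\<in>carrier B. \<one>\<^bsub>A\<^esub>)" "b = \<one>\<^bsub>B\<^esub>"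
    using Nil.prems by (auto simp: wreath_def)
  then show ?case
    by (intro exI[of _ "[]"] exI[of _ 0]) (auto simp: subset_iff)
next
  case (snoc s w)
  have w: "w \<in> lists S" and s: "s \<in> S" using snoc.prems by auto
  obtain f0 b0 where fb0: "word_prod W w = (f0, b0)" by fastforce
  then have car: "(f0, b0) \<in> carrier W" using W.word_prod_closed[OF S_carrier w] by simp
  then have b0: "b0 \<in> carrier B" "f0 b0 \<in> carrier A" by (auto simp: carrier_iff)
  obtain p m where pm: "length w = length p + m" "last (\<one>\<^bsub>B\<^esub> # p) = b0"
    "{x \<in> carrier B. f0 x \<noteq> \<one>\<^bsub>A\<^esub>} \<subseteq> set (\<one>\<^bsub>B\<^esub> # p)"
    "\<And>F. finite F \<Longrightarrow> F \<subseteq> carrier B \<Longrightarrow> (\<Sum>x\<in>F. len (f0 x)) \<le> m"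
    using snoc.IH[OF w fb0] by blast
  have fb: "(f, b) = (f0, b0) \<otimes>\<^bsub>W\<^esub> s"
    using snoc.prems(2) word_prod_snoc[OF w s] fb0 by simp
  from s consider a where "a \<in> S_A" "s = embed_base A B a" | c where "s = embed_top A B c" by blast
  then show ?case
  proof cases
    case 1
    then have f: "f = f0(b0 := f0 b0 \<otimes>\<^bsub>A\<^esub> a)" "b = b0"
      using mult_embed_base[OF car] S_A_carrier fb by auto
    \<comment> \<open>One letter of \<open>S_A\<close> changes only the lamp at \<open>b0\<close>,
      whose length grows by at most 1.\<close>
    have "(\<Sum>x\<in>F. len (f x)) \<le> m + 1" if F: "finite F" "F \<subseteq> carrier B" for F
    proof -
      have "len (f b0) \<le> len (f0 b0) + 1"
        using A.word_length_mult_generator[OF S_A b0(2) 1(1)] f by simp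
      moreover have "(\<Sum>x\<in>F - {b0}. len (f x)) = (\<Sum>x\<in>F - {b0}. len (f0 x))"
        using f by (intro sum.cong) auto
      ultimately have "(\<Sum>x\<in>F. len (f x)) \<le> (\<Sum>x\<in>F. len (f0 x)) + 1"
        using F f by (cases "b0 \<in> F") (auto simp: sum.remove)
      then show ?thesis using pm(4)[OF F] by linarith
    qed
    \<comment> \<open>A lamp can become nontrivial only under the cursor, which is at the start or
      at a recorded position.\<close>
    moreover have "b0 \<in> set (\<one>\<^bsub>B\<^esub> # p)" using pm(2) last_in_set[of "\<one>\<^bsub>B\<^esub> # p"] by blast
    then have "{x \<in> carrier B. f x \<noteq> \<one>\<^bsub>A\<^esub>} \<subseteq> set (\<one>\<^bsub>B\<^esub> # p)" using pm(3) f by auto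
    ultimately show ?thesis
      using pm(1,2) f(2) by (intro exI[of _ p] exI[of _ "m + 1"]) auto
  next
    case 2
    then have f: "f = f0" using mult_embed_top[OF car] fb by auto
    show ?thesis
      using pm f by (intro exI[of _ "p @ [b]"] exI[of _ m]) auto
  qed
qed

text \<open>Every letter either moves the cursor by one generator or adds one letter on the right of
  the lamp under it. So the depth of a lamp value in \<open>A\<close> can be applied at each point,
  and no lamp outside the ball is touched.\<close>

lemma word_perturbation:
  assumes "w \<in> lists S" "(f, \<one>\<^bsub>B\<^esub>) \<in> carrier W" "(f, \<one>\<^bsub>B\<^esub>) \<otimes>\<^bsub>W\<^esub> word_prod W w = (f', b)"
  shows "b \<in> B.ball S_B (length w) \<and>
    (\<forall>x\<in>carrier B. \<exists>c\<in>A.ball S_A (length w). f' x = f x \<otimes>\<^bsub>A\<^esub> c) \<and>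
    (\<forall>x. x \<notin> B.ball S_B (length w) \<longrightarrow> f' x = f x)"
  using assms(1,3)
proof (induction w arbitrary: f' b rule: rev_induct)
  case Nil
  have "f' = f" "b = \<one>\<^bsub>B\<^esub>" using Nil assms(2) by auto
  moreover have "f x = f x \<otimes>\<^bsub>A\<^esub> \<one>\<^bsub>A\<^esub>" if "x \<in> carrier B" for x
    using that assms(2) by (auto simp: carrier_iff PiE_iff)
  ultimately show ?case by (auto intro!: bexI[of _ "\<one>\<^bsub>A\<^esub>"])
next
  case (snoc s w)
  have w: "w \<in> lists S" and s: "s \<in> S" using snoc.prems by auto
  obtain f0 b0 where fb0: "(f, \<one>\<^bsub>B\<^esub>) \<otimes>\<^bsub>W\<^esub> word_prod W w = (f0, b0)" by fastforce
  have wc: "word_prod W w \<in> carrier W" by (rule W.word_prod_closed[OF S_carrier w])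
  have car: "(f0, b0) \<in> carrier W" using W.m_closed[OF assms(2) wc] fb0 by simp
  have b0: "b0 \<in> carrier B" using car by (auto simp: carrier_iff)
  have IH: "b0 \<in> B.ball S_B (length w)"
    "\<And>x. x \<in> carrier B \<Longrightarrow> \<exists>c\<in>A.ball S_A (length w). f0 x = f x \<otimes>\<^bsub>A\<^esub> c"
    "\<And>x. x \<notin> B.ball S_B (length w) \<Longrightarrow> f0 x = f x"
    using snoc.IH[OF w fb0] by blast+
  have "s \<in> carrier W" using s S_carrier by blast
  then have fb: "(f', b) = (f0, b0) \<otimes>\<^bsub>W\<^esub> s"
    using snoc.prems(2) word_prod_snoc[OF w s] W.m_assoc[OF assms(2) wc] fb0 by simp
  have monoA: "A.ball S_A (length w) \<subseteq> A.ball S_A (Suc (length w))"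
    and monoB: "B.ball S_B (length w) \<subseteq> B.ball S_B (Suc (length w))"
    by (intro A.ball_mono B.ball_mono; simp)+
  from s consider a where "a \<in> S_A" "s = embed_base A B a"
    | c where "c \<in> S_B" "s = embed_top A B c" by blast
  then show ?case
  proof cases
    case 1
    then have a: "a \<in> carrier A" using S_A_carrier by blast
    have f: "f' = f0(b0 := f0 b0 \<otimes>\<^bsub>A\<^esub> a)" "b = b0"
      using mult_embed_base[OF car a] fb 1 by auto
    obtain c where c: "c \<in> A.ball S_A (length w)" "f0 b0 = f b0 \<otimes>\<^bsub>A\<^esub> c"
      using IH(2)[OF b0] by blast
    have "a \<in> A.ball S_A 1" using A.subset_ball[OF S_A_carrier] 1 by auto
    then have "c \<otimes>\<^bsub>A\<^esub> a \<in> A.ball S_A (Suc (length w))"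
      using A.ball_mult[OF S_A_carrier c(1), of a 1] by simp
    moreover have "f' b0 = f b0 \<otimes>\<^bsub>A\<^esub> (c \<otimes>\<^bsub>A\<^esub> a)"
    proof -
      have "f b0 \<in> carrier A" using assms(2) b0 by (auto simp: carrier_iff)
      moreover have "c \<in> carrier A" using c A.ball_subset_carrier[OF S_A_carrier] by blast
      ultimately show ?thesis using f c a by (simp add: A.m_assoc)
    qed
    ultimately have "\<exists>c\<in>A.ball S_A (Suc (length w)). f' x = f x \<otimes>\<^bsub>A\<^esub> c" if "x \<in> carrier B" for x
      using IH(2)[OF that] monoA f by (cases "x = b0") auto
    then show ?thesis using IH monoB f by auto
  next
    case 2
    then have f: "f' = f0" "b = b0 \<otimes>\<^bsub>B\<^esub> c" using mult_embed_top[OF car] fb by auto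
    have "c \<in> B.ball S_B 1" using B.subset_ball[OF S_B_carrier] 2 by auto
    then have "b \<in> B.ball S_B (Suc (length w))"
      using B.ball_mult[OF S_B_carrier IH(1), of c 1] f by simp
    then show ?thesis using IH monoA monoB f by (simp) blast
  qed
qed

section \<open>Hamiltonian tours as matching upper and lower bounds\<close>

text \<open>A Hamiltonian path from the identity to \<open>b\<close> needs \<open>card F - 1\<close>
  moves; if \<open>b\<close> is the identity, the path ends at a neighbour \<open>u\<close> and one
  more move closes the tour. So \<open>card F\<close> moves suffice for every \<open>b\<close>, and
  none are made when \<open>F\<close> is a singleton.\<close>

lemma reach_ham_connected:
  assumes F: "finite F" "F \<subseteq> carrier B" "\<one>\<^bsub>B\<^esub> \<in> F"
    and ham: "\<And>v. v \<in> F \<Longrightarrow> v \<noteq> \<one>\<^bsub>B\<^esub> \<Longrightarrow> \<exists>p. ham_path (B.cayley S_B) F \<one>\<^bsub>B\<^esub> v p"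
    and adj: "F = {\<one>\<^bsub>B\<^esub>} \<or> (\<exists>u\<in>F. u \<noteq> \<one>\<^bsub>B\<^esub> \<and> (u, \<one>\<^bsub>B\<^esub>) \<in> B.cayley S_B)"
    and f: "(f, b) \<in> carrier W" "\<And>x. x \<in> carrier B \<Longrightarrow> x \<notin> F \<Longrightarrow> f x = \<one>\<^bsub>A\<^esub>"
    and N: "\<And>x. x \<in> F \<Longrightarrow> len (f x) \<le> N" and b: "b \<in> F"
  shows "\<exists>n \<le> card F * N + (if F = {\<one>\<^bsub>B\<^esub>} then 0 else card F). reach \<one>\<^bsub>W\<^esub> n (f, b)"
proof -
  define e where "e = (\<lambda>x\<in>carrier B. \<one>\<^bsub>A\<^esub>)"
  have one: "\<one>\<^bsub>W\<^esub> = (e, \<one>\<^bsub>B\<^esub>)" by (simp add: wreath_def e_def)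
  have sum: "(\<Sum>x\<in>F. len (f x)) \<le> card F * N"
    using sum_bounded_above[of F "\<lambda>x. len (f x)" N] N by simp
  have path: "reach \<one>\<^bsub>W\<^esub> ((\<Sum>x\<in>F. len (f x)) + (card F - 1)) (f, v)"
    if p: "ham_path (B.cayley S_B) F \<one>\<^bsub>B\<^esub> v p" for v p
  proof -
    have p': "p \<noteq> []" "distinct p" "set p = F" "hd p = \<one>\<^bsub>B\<^esub>" "last p = v"
      "successively (\<lambda>x y. (x, y) \<in> B.cayley S_B) p"
      using p by (auto simp: ham_path_def)
    have "reach (e, hd p) ((\<Sum>x\<in>set p. len (f x)) + (length p - 1)) (f, last p)"
    proof (rule reach_along_path)
      show "(e, hd p) \<in> carrier W" using one p' W.one_closed by simp
      show "f x \<in> carrier A" if "x \<in> set p" for x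
        using that p'(3) F f(1) by (auto simp: carrier_iff)
      show "f x = e x" if "x \<notin> set p" for x
      proof (cases "x \<in> carrier B")
        case True
        then show ?thesis using that p'(3) f(2)[of x] by (simp add: e_def)
      next
        case False
        \<comment> \<open>Outside the carrier both functions are \<open>undefined\<close>, being
          extensional.\<close>
        have "f \<in> carrier B \<rightarrow>\<^sub>E carrier A" using f(1) by (simp add: carrier_iff)
        then show ?thesis using False PiE_arb[of f] by (simp add: e_def)
      qed
      show "e x = \<one>\<^bsub>A\<^esub>" if "x \<in> set p" for x
        using that p'(3) F(2) by (auto simp: e_def)
    qed (simp_all add: p' F)
    then show ?thesis using p' one distinct_card[of p] by simp
  qed
  show ?thesis
  proof (cases "F = {\<one>\<^bsub>B\<^esub>}")
    case True
    have "ham_path (B.cayley S_B) F \<one>\<^bsub>B\<^esub> b [\<one>\<^bsub>B\<^esub>]" using True b by (simp add: ham_path_def)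
    from path[OF this] show ?thesis using sum True by (intro exI conjI) auto
  next
    case False
    \<comment> \<open>Makes the truncated \<open>card F - 1\<close> plus the closing move equal to
      \<open>card F\<close>.\<close>
    have pos: "card F > 0" using F card_gt_0_iff by blast
    show ?thesis
    proof (cases "b = \<one>\<^bsub>B\<^esub>")
      case True
      obtain u where u: "u \<in> F" "u \<noteq> \<one>\<^bsub>B\<^esub>" "(u, \<one>\<^bsub>B\<^esub>) \<in> B.cayley S_B"
        using adj False by blast
      then obtain p where "ham_path (B.cayley S_B) F \<one>\<^bsub>B\<^esub> u p" using ham by blast
      note path[OF this]
      moreover have "(f, u) \<in> carrier W" using f(1) u(1) F(2) by (auto simp: carrier_iff)
      then have "reach (f, u) 1 (f, b)" using reach_top u(3) True by blast
      ultimately have "reach \<one>\<^bsub>W\<^esub> ((\<Sum>x\<in>F. len (f x)) + (card F - 1) + 1) (f, b)"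
        using reach_trans W.one_closed by blast
      then show ?thesis using sum False pos by (intro exI conjI) auto
    next
      case b1: False
      then obtain p where "ham_path (B.cayley S_B) F \<one>\<^bsub>B\<^esub> b p" using ham b by blast
      from path[OF this] show ?thesis using sum False by (intro exI conjI) auto
    qed
  qed
qed

text \<open>The letters of \<open>S_A\<close> number at least the sum of the lamp lengths over
  \<open>F\<close>, and the cursor must visit all of \<open>F\<close> because \<open>a\<close> is
  nontrivial. The premise \<open>reach\<close> supplies some word, so that the \<open>LEAST\<close>
  in \<open>word_length\<close> is attained.\<close>

lemma word_length_ge_tour:
  assumes F: "finite F" "F \<subseteq> carrier B" "\<one>\<^bsub>B\<^esub> \<in> F"
    and reach: "reach \<one>\<^bsub>W\<^esub> n (f, \<one>\<^bsub>B\<^esub>)"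
    and f: "\<And>x. x \<in> F \<Longrightarrow> f x = a" "a \<noteq> \<one>\<^bsub>A\<^esub>"
  shows "card F * len a + (if F = {\<one>\<^bsub>B\<^esub>} then 0 else card F) \<le> word_length W S (f, \<one>\<^bsub>B\<^esub>)"
proof -
  obtain w where w: "w \<in> lists S" "\<one>\<^bsub>W\<^esub> \<otimes>\<^bsub>W\<^esub> word_prod W w = (f, \<one>\<^bsub>B\<^esub>)"
    using reach by (auto simp: reach_def)
  then have "word_prod W w = (f, \<one>\<^bsub>B\<^esub>)" using W.word_prod_closed[OF S_carrier w(1)] by simp
  with w(1) obtain v where v: "v \<in> lists S" "word_prod W v = (f, \<one>\<^bsub>B\<^esub>)"
    "length v = word_length W S (f, \<one>\<^bsub>B\<^esub>)"
    by (rule word_length_witness)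
  obtain p m where pm: "length v = length p + m" "last (\<one>\<^bsub>B\<^esub> # p) = \<one>\<^bsub>B\<^esub>"
    "{x \<in> carrier B. f x \<noteq> \<one>\<^bsub>A\<^esub>} \<subseteq> set (\<one>\<^bsub>B\<^esub> # p)"
    "\<And>F. finite F \<Longrightarrow> F \<subseteq> carrier B \<Longrightarrow> (\<Sum>x\<in>F. len (f x)) \<le> m"
    using word_decomposition[OF v(1,2)] by blast
  have "(\<Sum>x\<in>F. len (f x)) = card F * len a" using f by simp
  then have m: "card F * len a \<le> m" using pm(4)[OF F(1,2)] by simp
  have sub: "F \<subseteq> set (\<one>\<^bsub>B\<^esub> # p)" using pm(3) f F(2) by blast
  have "card F \<le> length p" if "F \<noteq> {\<one>\<^bsub>B\<^esub>}"
  proof -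
    \<comment> \<open>The starting position is not recorded in \<open>p\<close>, but the return to
      it is; this gives \<open>card F\<close> moves rather than \<open>card F - 1\<close>.\<close>
    have "p \<noteq> []" using sub that F(3) by auto
    then have "\<one>\<^bsub>B\<^esub> \<in> set p" using pm(2) last_in_set[of p] by simp
    then have "F \<subseteq> set p" using sub by auto
    then show ?thesis by (meson List.finite_set card_length card_mono order_trans)
  qed
  then show ?thesis using m pm(1) v(3) by (cases "F = {\<one>\<^bsub>B\<^esub>}") simp_all
qed

text \<open>The element with lamp \<open>a\<close> on \<open>F\<close> and cursor at the identity
  has length at least \<open>K\<close>. After at most \<open>n\<close> letters the cursor is in
  \<open>F\<close>, lamps off \<open>F\<close> are trivial and those in \<open>F\<close> are no
  longer than \<open>a\<close>, so a tour still gives a word of length at most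
  \<open>K\<close>.\<close>

lemma deep_dead_end:
  assumes F: "finite F" "F \<subseteq> carrier B" "B.ball S_B n \<subseteq> F"
    and ham: "\<And>v. v \<in> F \<Longrightarrow> v \<noteq> \<one>\<^bsub>B\<^esub> \<Longrightarrow> \<exists>p. ham_path (B.cayley S_B) F \<one>\<^bsub>B\<^esub> v p"
    and adj: "F = {\<one>\<^bsub>B\<^esub>} \<or> (\<exists>u\<in>F. u \<noteq> \<one>\<^bsub>B\<^esub> \<and> (u, \<one>\<^bsub>B\<^esub>) \<in> B.cayley S_B)"
    and a: "a \<in> carrier A" "a \<noteq> \<one>\<^bsub>A\<^esub>"
    and deep: "\<And>c. c \<in> A.ball S_A n \<Longrightarrow> len (a \<otimes>\<^bsub>A\<^esub> c) \<le> len a" and n: "n \<ge> 1"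
  shows "\<exists>g. dead_end W S g \<and> depth W S g \<ge> enat n"
proof -
  define f where "f = (\<lambda>x\<in>carrier B. if x \<in> F then a else \<one>\<^bsub>A\<^esub>)"
  define K where "K = card F * len a + (if F = {\<one>\<^bsub>B\<^esub>} then 0 else card F)"
  have oneF: "\<one>\<^bsub>B\<^esub> \<in> F" using F(3) B.one_in_ball by blast
  have "{x \<in> carrier B. f x \<noteq> \<one>\<^bsub>A\<^esub>} \<subseteq> F" by (auto simp: f_def)
  then have "finite {x \<in> carrier B. f x \<noteq> \<one>\<^bsub>A\<^esub>}" using F(1) by (rule finite_subset)
  then have g: "(f, \<one>\<^bsub>B\<^esub>) \<in> carrier W" using a by (auto simp: carrier_iff f_def)
  have fF: "f x = a" if "x \<in> F" for x using that F(2) by (auto simp: f_def)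
  have out: "f x = \<one>\<^bsub>A\<^esub>" if "x \<in> carrier B" "x \<notin> F" for x using that by (simp add: f_def)
  \<comment> \<open>Here only the existence of a word for the element matters; the lower bound
    requires one.\<close>
  have "\<exists>m\<le>K. reach \<one>\<^bsub>W\<^esub> m (f, \<one>\<^bsub>B\<^esub>)"
    unfolding K_def
    by (rule reach_ham_connected[OF F(1,2) oneF ham adj g]) (simp_all add: fF oneF out)
  then have lower: "K \<le> word_length W S (f, \<one>\<^bsub>B\<^esub>)"
    unfolding K_def using word_length_ge_tour[where f = f and a = a, OF F(1,2) oneF _ fF a(2)] by blast
  have upper: "word_length W S ((f, \<one>\<^bsub>B\<^esub>) \<otimes>\<^bsub>W\<^esub> word_prod W w) \<le> word_length W S (f, \<one>\<^bsub>B\<^esub>)"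
    if w: "w \<in> lists S" "length w \<le> n" for w
  proof -
    obtain f' b where h: "(f, \<one>\<^bsub>B\<^esub>) \<otimes>\<^bsub>W\<^esub> word_prod W w = (f', b)" by fastforce
    have h_car: "(f', b) \<in> carrier W"
      using W.m_closed[OF g W.word_prod_closed[OF S_carrier w(1)]] h by simp
    have ballB: "B.ball S_B (length w) \<subseteq> F" using B.ball_mono[OF w(2)] F(3) by blast
    have pert: "b \<in> F" "\<And>x. x \<notin> F \<Longrightarrow> f' x = f x"
      "\<And>x. x \<in> carrier B \<Longrightarrow> \<exists>c\<in>A.ball S_A (length w). f' x = f x \<otimes>\<^bsub>A\<^esub> c"
      using word_perturbation[OF w(1) g h] ballB by auto
    have "len (f' x) \<le> len a" if "x \<in> F" for x
    proof -
      have "x \<in> carrier B" using that F(2) by (rule subsetD[rotated])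
      then obtain c where c: "c \<in> A.ball S_A (length w)" "f' x = f x \<otimes>\<^bsub>A\<^esub> c"
        using pert(3)[of x] by auto
      have "c \<in> A.ball S_A n" using A.ball_mono[OF w(2)] c(1) by (rule subsetD)
      with c(2) show ?thesis using deep[of c] fF[OF that] by simp
    qed
    then obtain m where m: "m \<le> K" "reach \<one>\<^bsub>W\<^esub> m (f', b)"
      using reach_ham_connected[where N = "len a", OF F(1,2) oneF ham adj h_car _ _ pert(1)]
        pert(2) out unfolding K_def by fastforce
    show ?thesis
      using word_length_le_reach[OF m(2) h_car] m(1) lower h by simp
  qed
  \<comment> \<open>Generators are covered as one-letter words, since
    \<open>n \<ge> 1\<close>.\<close>
  have "word_length W S ((f, \<one>\<^bsub>B\<^esub>) \<otimes>\<^bsub>W\<^esub> s) \<le> word_length W S (f, \<one>\<^bsub>B\<^esub>)" if "s \<in> S" for s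
  proof -
    have "s \<in> carrier W" using that S_carrier by blast
    then show ?thesis using upper[of "[s]"] that n by simp
  qed
  then have "dead_end W S (f, \<one>\<^bsub>B\<^esub>)" using g by (simp add: dead_end_def)
  moreover have "depth W S (f, \<one>\<^bsub>B\<^esub>) \<ge> enat n" using n upper by (rule depth_geI)
  ultimately show ?thesis by blast
qed

end

theorem theoremA:
  fixes A :: "('a, 'c) monoid_scheme" and B :: "('b, 'd) monoid_scheme" and S_A :: "'a set"
  assumes "group A" and "carrier A \<noteq> {\<one>\<^bsub>A\<^esub>}" and "fin_gen A"
    and "sym_gen_set A S_A" and "unbounded_depth A S_A"
    and "group B" and "fin_gen B"
  shows "\<exists>S_B. sym_gen_set B S_B \<and>
           unbounded_depth (wreath A B) (embed_base A B ` S_A \<union> embed_top A B ` S_B)"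
proof -
  interpret A: group A by fact
  interpret B: group B by fact
  obtain T where T: "sym_gen_set B T" using B.fin_gen_sym_gen_set[OF assms(7)] .
  then have T': "finite T" "T \<subseteq> carrier B" "\<forall>t\<in>T. inv\<^bsub>B\<^esub> t \<in> T"
    by (auto simp: sym_gen_set_def)
  define S_B where "S_B = B.ball T 3"
  have S_B: "sym_gen_set B S_B" unfolding S_B_def using B.sym_gen_set_ball[OF T] by simp
  interpret wreath_gens A B S_A S_B
    by unfold_locales (rule assms(4) S_B)+
  have cube: "cube (B.cayley T) \<subseteq> B.cayley S_B"
    unfolding S_B_def by (rule B.cube_cayley[OF T'(2)])
  have "\<exists>g. dead_end W S g \<and> depth W S g \<ge> enat n" for n
  proof -
    \<comment> \<open>The successor ensures \<open>k \<ge> 1\<close>, as \<open>depth_geD\<close>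
      and \<open>deep_dead_end\<close> require, also when \<open>n = 0\<close>.\<close>
    define k where "k = Suc n"
    define F where "F = B.ball T (3 * k)"
    have F: "finite F" "F \<subseteq> carrier B" "\<one>\<^bsub>B\<^esub> \<in> F"
      unfolding F_def using T' B.finite_ball B.ball_subset_carrier B.one_in_ball by auto
    have conn: "connected_in (B.cayley T) F"
      unfolding F_def by (rule B.connected_in_ball[OF T'(2,3)])
    have sym: "sym (B.cayley T)" by (rule B.sym_cayley[OF T'(3)])
    have ham: "\<exists>p. ham_path (B.cayley S_B) F \<one>\<^bsub>B\<^esub> v p" if v: "v \<in> F" "v \<noteq> \<one>\<^bsub>B\<^esub>" for v
    proof -
      obtain p where "ham_path (cube (B.cayley T)) F \<one>\<^bsub>B\<^esub> v p"
        using ham_path_cube[OF sym F(1) conn F(3) v(1)] v(2) by blast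
      then have "ham_path (B.cayley S_B) F \<one>\<^bsub>B\<^esub> v p" using cube by (rule ham_path_mono)
      then show ?thesis ..
    qed
    have adj: "F = {\<one>\<^bsub>B\<^esub>} \<or> (\<exists>u\<in>F. u \<noteq> \<one>\<^bsub>B\<^esub> \<and> (u, \<one>\<^bsub>B\<^esub>) \<in> B.cayley S_B)"
    proof (cases "F = {\<one>\<^bsub>B\<^esub>}")
      case False
      then obtain v where "v \<in> F" "\<one>\<^bsub>B\<^esub> \<noteq> v" using F(3) by blast
      then obtain u where u: "u \<in> F" "u \<noteq> \<one>\<^bsub>B\<^esub>" "(\<one>\<^bsub>B\<^esub>, u) \<in> B.cayley T"
        using connected_in_neighbour[OF conn F(3)] by blast
      then have "(u, \<one>\<^bsub>B\<^esub>) \<in> B.cayley T" using sym by (blast dest: symD)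
      \<comment> \<open>An edge lies in the cube with both outer steps idle.\<close>
      then have "(u, \<one>\<^bsub>B\<^esub>) \<in> B.cayley S_B" using cube by blast
      then show ?thesis using u by blast
    qed simp
    obtain a where a: "dead_end A S_A a" "depth A S_A a \<ge> enat k"
      using assms(5) unfolding unbounded_depth_def by blast
    have deep: "len (a \<otimes>\<^bsub>A\<^esub> c) \<le> len a" if "c \<in> A.ball S_A k" for c
      using that depth_geD[OF a(2)] by (auto simp: k_def elim!: A.ballE)
    have "\<exists>g. dead_end W S g \<and> depth W S g \<ge> enat k"
    proof (rule deep_dead_end[OF F(1,2) _ ham adj _ _ deep])
      show "B.ball S_B k \<subseteq> F"
        unfolding S_B_def F_def by (rule B.ball_ball[OF T'(2)])
      show "a \<in> carrier A" using a(1) by (simp add: dead_end_def)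
      show "a \<noteq> \<one>\<^bsub>A\<^esub>" by (rule A.dead_end_nontrivial[OF assms(4,2) a(1)])
    qed (simp_all add: k_def)
    moreover have "enat n \<le> enat k" by (simp add: k_def)
    ultimately show ?thesis using order_trans by blast
  qed
  then show ?thesis using S_B unfolding unbounded_depth_def by blast
qed

end
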